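(* Let $\mathcal{T}_n$ be the (empirical) CART tree based on the data set $\mathcal{D}_n$. Then $$\widehat{\mathbb{V}[Y]} = \sum_{j=1}^d \widehat{\mathrm{MDI}}_{\mathcal{T}_n}(X^{(j)}) + R_n(f_{\mathcal{T}_n}),$$ where $f_{\mathcal{T}_n}$ is the estimate associated with $\mathcal{T}_n$.
   Context: $\mathcal{D}_n=\{(\mathbf{X}_i,Y_i), i=1,\dots,n\}$ are i.i.d. copies of $(\mathbf{X},Y)$ with $\mathbf{X}\in[0,1]^d$, $Y\in\mathbb{R}$, $\mathbb{E}[Y^2]<\infty$. $\widehat{\mathbb{V}[Y]}=\frac1n\sum_{i=1}^n(Y_i-\bar Y)^2$, with $\bar Y=\frac1n\sum_i Y_i$, is the empirical variance of $Y$ on $\mathcal{D}_n$, and $R_n(f)=\frac1n\sum_{i=1}^n(Y_i-f(\mathbf{X}_i))^2$ for $f:[0,1]^d\to\mathbb{R}$. A cell is a hyperrectangle $A\subset[0,1]^d$; $N_n(A)$ is the number of data points $\mathbf{X}_i$ in $A$. A split of $A$ is a pair $(j,z)$ with $j\in\{1,\dots,d\}$ and $z$ the position of the cut along the $j$-th coordinate, within the limits of $A$; $\mathcal{C}_A$ is the set of all splits of $A$. A split produces $A_L=\{\mathbf{x}\in A:x^{(j)}<z\}$ and $A_R=\{\mathbf{x}\in A:x^{(j)}\ge z\}$. The empirical CART-split criterion is $$L_{n,A}(j,z)=\frac{1}{N_n(A)}\sum_{i=1}^n(Y_i-\bar Y_A)^2\mathbf{1}_{\mathbf{X}_i\in A}-\frac{1}{N_n(A)}\sum_{i=1}^n\big(Y_i-\bar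 Y_{A_L}\mathbf{1}_{X_i^{(j)}<z}-\bar Y_{A_R}\mathbf{1}_{X_i^{(j)}\ge z}\big)^2\mathbf{1}_{\mathbf{X}_i\in A},$$ where $\bar Y_B$ is the average of the $Y_i$ with $\mathbf{X}_i\in B$ (convention $0/0=0$). The CART tree $\mathcal{T}_n$ has root $[0,1]^d$; each cell $A$ containing more than nodesize observations (nodesize $\geq 1$ is a fixed integer input of the procedure) is split at a best split $(j_{n,A},z_{n,A})\in\arg\max_{(j,z)\in\mathcal{C}_A}L_{n,A}(j,z)$, the cut being placed at the middle of two consecutive data points to remove ties; the other cells are leaves. The associated estimate $f_{\mathcal{T}_n}(\mathbf{x})$ is the average of the $Y_i$ falling into the same leaf as $\mathbf{x}$. The empirical MDI is $$\widehat{\mathrm{MDI}}_{\mathcal{T}_n}(X^{(j)})=\sum_{A\in\mathcal{T}_n,\;j_{n,A}=j}p_{n,A}\,L_{n,A}(j_{n,A},z_{n,A}),$$ the sum being over all cells of $\mathcal{T}_n$ that are split along variable $j$, with $p_{n,A}=N_n(A)/n$. *)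

theory Defs
  imports "HOL-Probability.Probability"
begin

text \<open>
  A data set is given by its size \<open>n\<close> and its points \<open>(X i, Y i)\<close> for \<open>i \<in> {1..n}\<close>;
  the values of \<open>X\<close> and \<open>Y\<close> at other indices play no role.
  The convention \<open>0/0 = 0\<close> for empty averages is that of division in HOL.
\<close>

definition emp_mean :: "nat \<Rightarrow> (nat \<Rightarrow> real) \<Rightarrow> real" where
  "emp_mean n Y = (\<Sum>i=1..n. Y i) / real n"

definition emp_variance :: "nat \<Rightarrow> (nat \<Rightarrow> real) \<Rightarrow> real" where
  "emp_variance n Y = (\<Sum>i=1..n. (Y i - emp_mean n Y)\<^sup>2) / real n"

definition emp_risk ::
  "nat \<Rightarrow> (nat \<Rightarrow> real ^ 'd) \<Rightarrow> (nat \<Rightarrow> real) \<Rightarrow> (real ^ 'd \<Rightarrow> real) \<Rightarrow> real" where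
  "emp_risk n X Y f = (\<Sum>i=1..n. (Y i - f (X i))\<^sup>2) / real n"

definition obs :: "nat \<Rightarrow> (nat \<Rightarrow> real ^ 'd) \<Rightarrow> (real ^ 'd) set \<Rightarrow> nat set" where
  "obs n X A = {i \<in> {1..n}. X i \<in> A}"

definition num_obs :: "nat \<Rightarrow> (nat \<Rightarrow> real ^ 'd) \<Rightarrow> (real ^ 'd) set \<Rightarrow> nat" where
  "num_obs n X A = card (obs n X A)"

definition cell_mean ::
  "nat \<Rightarrow> (nat \<Rightarrow> real ^ 'd) \<Rightarrow> (nat \<Rightarrow> real) \<Rightarrow> (real ^ 'd) set \<Rightarrow> real" where
  "cell_mean n X Y A = (\<Sum>i\<in>obs n X A. Y i) / real (num_obs n X A)"

definition left_cell :: "(real ^ 'd) set \<Rightarrow> 'd \<Rightarrow> real \<Rightarrow> (real ^ 'd) set" where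
  "left_cell A j z = {x \<in> A. x $ j < z}"

definition right_cell :: "(real ^ 'd) set \<Rightarrow> 'd \<Rightarrow> real \<Rightarrow> (real ^ 'd) set" where
  "right_cell A j z = {x \<in> A. x $ j \<ge> z}"

text \<open>For a hyperrectangle, its projection on the \<open>j\<close>-th axis is its \<open>j\<close>-th side.\<close>

definition splits :: "(real ^ 'd) set \<Rightarrow> ('d \<times> real) set" where
  "splits A = {(j, z). z \<in> (\<lambda>x. x $ j) ` A}"

definition cart_criterion ::
  "nat \<Rightarrow> (nat \<Rightarrow> real ^ 'd) \<Rightarrow> (nat \<Rightarrow> real) \<Rightarrow> (real ^ 'd) set \<Rightarrow> 'd \<times> real \<Rightarrow> real" where
  "cart_criterion n X Y A = (\<lambda>(j, z).
     1 / real (num_obs n X A) *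
       (\<Sum>i=1..n. (Y i - cell_mean n X Y A)\<^sup>2 * indicator A (X i))
   - 1 / real (num_obs n X A) *
       (\<Sum>i=1..n. (Y i - cell_mean n X Y (left_cell A j z) * indicator {x. x $ j < z} (X i)
                       - cell_mean n X Y (right_cell A j z) * indicator {x. x $ j \<ge> z} (X i))\<^sup>2
                  * indicator A (X i)))"

definition midpoint_split ::
  "nat \<Rightarrow> (nat \<Rightarrow> real ^ 'd) \<Rightarrow> (real ^ 'd) set \<Rightarrow> 'd \<times> real \<Rightarrow> bool" where
  "midpoint_split n X A = (\<lambda>(j, z). \<exists>i\<in>obs n X A. \<exists>k\<in>obs n X A.
     X i $ j < X k $ j \<and>
     \<not> (\<exists>l\<in>obs n X A. X i $ j < X l $ j \<and> X l $ j < X k $ j) \<and>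
     z = (X i $ j + X k $ j) / 2)"

text \<open>
  A best split maximises the criterion over all splits of the cell. The criterion does not change
  while the cut moves between two consecutive data points, and the midpoint condition selects one
  representative. Ties between different gaps or directions may be broken arbitrarily.
\<close>

definition best_split ::
  "nat \<Rightarrow> (nat \<Rightarrow> real ^ 'd) \<Rightarrow> (nat \<Rightarrow> real) \<Rightarrow> (real ^ 'd) set \<Rightarrow> 'd \<times> real \<Rightarrow> bool" where
  "best_split n X Y A s \<longleftrightarrow>
     is_arg_max (cart_criterion n X Y A) (\<lambda>t. t \<in> splits A) s \<and> midpoint_split n X A s"

datatype 'd split_tree = Terminal | Split 'd real "'d split_tree" "'d split_tree"

text \<open>
  \<open>is_cart_tree m n X Y A T\<close>: \<open>T\<close> is a tree grown by the procedure from the cell \<open>A\<close>, with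
  nodesize \<open>m\<close>. Rule \<open>tied\<close> only concerns data with repeated points: if all observations
  in a cell coincide, no cut between two data points exists, and the cell is a leaf.
\<close>

inductive is_cart_tree ::
  "nat \<Rightarrow> nat \<Rightarrow> (nat \<Rightarrow> real ^ 'd) \<Rightarrow> (nat \<Rightarrow> real) \<Rightarrow> (real ^ 'd) set \<Rightarrow> 'd split_tree \<Rightarrow> bool"
  for m n X Y where
  small: "num_obs n X A \<le> m \<Longrightarrow> is_cart_tree m n X Y A Terminal"
| tied: "(\<And>i k. i \<in> obs n X A \<Longrightarrow> k \<in> obs n X A \<Longrightarrow> X i = X k) \<Longrightarrow>
    is_cart_tree m n X Y A Terminal"
| split: "num_obs n X A > m \<Longrightarrow> best_split n X Y A (j, z) \<Longrightarrow>
    is_cart_tree m n X Y (left_cell A j z) l \<Longrightarrow>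
    is_cart_tree m n X Y (right_cell A j z) r \<Longrightarrow>
    is_cart_tree m n X Y A (Split j z l r)"

text \<open>The cells of a tree rooted at a cell: those which are split, together with their splits, and the leaves.\<close>

primrec split_cells ::
  "(real ^ 'd) set \<Rightarrow> 'd split_tree \<Rightarrow> ((real ^ 'd) set \<times> 'd \<times> real) set" where
  "split_cells A Terminal = {}"
| "split_cells A (Split j z l r) =
     {(A, j, z)} \<union> split_cells (left_cell A j z) l \<union> split_cells (right_cell A j z) r"

primrec leaf_cells :: "(real ^ 'd) set \<Rightarrow> 'd split_tree \<Rightarrow> (real ^ 'd) set set" where
  "leaf_cells A Terminal = {A}"
| "leaf_cells A (Split j z l r) =
     leaf_cells (left_cell A j z) l \<union> leaf_cells (right_cell A j z) r"

abbreviation root_cell :: "(real ^ 'd) set" where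
  "root_cell \<equiv> {x. \<forall>j. 0 \<le> x $ j \<and> x $ j \<le> 1}"

definition tree_estimate ::
  "nat \<Rightarrow> (nat \<Rightarrow> real ^ 'd) \<Rightarrow> (nat \<Rightarrow> real) \<Rightarrow> 'd split_tree \<Rightarrow> real ^ 'd \<Rightarrow> real" where
  "tree_estimate n X Y T x =
     (let I = {i \<in> {1..n}. \<exists>A\<in>leaf_cells root_cell T. x \<in> A \<and> X i \<in> A}
      in (\<Sum>i\<in>I. Y i) / real (card I))"

definition emp_MDI ::
  "nat \<Rightarrow> (nat \<Rightarrow> real ^ 'd) \<Rightarrow> (nat \<Rightarrow> real) \<Rightarrow> 'd split_tree \<Rightarrow> 'd \<Rightarrow> real" where
  "emp_MDI n X Y T j =
     (\<Sum>(A, j', z) \<in> {(A, j', z) \<in> split_cells root_cell T. j' = j}.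
        real (num_obs n X A) / real n * cart_criterion n X Y A (j', z))"

end

theory Submission
  imports Defs
begin

text \<open>
  A best split of a cell \<open>A\<close> lowers the residual sum of squares by exactly
  \<open>N\<^sub>n(A) L\<^sub>n\<^sub>,\<^sub>A\<close>, since the second term of the criterion is the residual sum of squares
  of the two children. Telescoping along the tree turns the residual sum of squares of the root
  into that of the leaves plus the sum of all decreases; dividing by \<open>n\<close> gives the identity.
\<close>

definition residual_ss ::
  "nat \<Rightarrow> (nat \<Rightarrow> real ^ 'd) \<Rightarrow> (nat \<Rightarrow> real) \<Rightarrow> (real ^ 'd) set \<Rightarrow> real" where
  "residual_ss n X Y A = (\<Sum>i\<in>obs n X A. (Y i - cell_mean n X Y A)\<^sup>2)"

text \<open>Generalises \<open>tree_estimate\<close> from \<open>root_cell\<close> to an arbitrary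
  starting cell, so that an induction can pass to the subtrees hanging from the two
  children.\<close>

definition subtree_estimate ::
  "nat \<Rightarrow> (nat \<Rightarrow> real ^ 'd) \<Rightarrow> (nat \<Rightarrow> real) \<Rightarrow> (real ^ 'd) set \<Rightarrow> 'd split_tree \<Rightarrow> real ^ 'd \<Rightarrow> real"
  where
  "subtree_estimate n X Y A T x =
     (let I = {i \<in> {1..n}. \<exists>C\<in>leaf_cells A T. x \<in> C \<and> X i \<in> C}
      in (\<Sum>i\<in>I. Y i) / real (card I))"

lemma finite_obs [simp]: "finite (obs n X A)"
  by (simp add: obs_def)

lemma sum_obs_indicator:
  "(\<Sum>i=1..n. f i * indicator A (X i)) = (\<Sum>i\<in>obs n X A. f i :: real)"
  unfolding obs_def by (rule sum.mono_neutral_cong_right) auto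

lemma sum_obs_children:
  "(\<Sum>i\<in>obs n X A. f i) =
     (\<Sum>i\<in>obs n X (left_cell A j z). f i) + (\<Sum>i\<in>obs n X (right_cell A j z). f i :: real)"
proof -
  have "obs n X A = obs n X (left_cell A j z) \<union> obs n X (right_cell A j z)"
    by (auto simp: obs_def left_cell_def right_cell_def)
  moreover have "obs n X (left_cell A j z) \<inter> obs n X (right_cell A j z) = {}"
    by (auto simp: obs_def left_cell_def right_cell_def)
  ultimately show ?thesis
    by (simp add: sum.union_disjoint)
qed

lemma num_obs_times_cart_criterion:
  assumes "num_obs n X A > 0"
  shows "real (num_obs n X A) * cart_criterion n X Y A (j, z) =
    residual_ss n X Y A - residual_ss n X Y (left_cell A j z) - residual_ss n X Y (right_cell A j z)"
proof -
  let ?g = "\<lambda>i. (Y i - cell_mean n X Y (left_cell A j z) * indicator {x. x $ j < z} (X i)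
                     - cell_mean n X Y (right_cell A j z) * indicator {x. x $ j \<ge> z} (X i))\<^sup>2"
  \<comment> \<open>On each child one of the two indicators is 1 and the other 0, so
    \<open>?g\<close> is there the squared deviation from that child's own mean.\<close>
  have L: "(\<Sum>i\<in>obs n X (left_cell A j z). ?g i) = residual_ss n X Y (left_cell A j z)"
    unfolding residual_ss_def by (rule sum.cong) (auto simp: obs_def left_cell_def)
  have R: "(\<Sum>i\<in>obs n X (right_cell A j z). ?g i) = residual_ss n X Y (right_cell A j z)"
    unfolding residual_ss_def by (rule sum.cong) (auto simp: obs_def right_cell_def)
  have "(\<Sum>i\<in>obs n X A. ?g i) =
      residual_ss n X Y (left_cell A j z) + residual_ss n X Y (right_cell A j z)"
    unfolding L[symmetric] R[symmetric] by (rule sum_obs_children)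
  then show ?thesis
    using assms unfolding cart_criterion_def sum_obs_indicator residual_ss_def[of n X Y A]
    by (simp add: right_diff_distrib)
qed

lemma left_cell_subset: "left_cell A j z \<subseteq> A"
  by (auto simp: left_cell_def)

lemma right_cell_subset: "right_cell A j z \<subseteq> A"
  by (auto simp: right_cell_def)

lemma leaf_cells_subset: "C \<in> leaf_cells A T \<Longrightarrow> C \<subseteq> A"
proof (induction T arbitrary: A)
  case (Split j z l r)
  then show ?case
    using left_cell_subset[of A j z] right_cell_subset[of A j z] by (metis UnE leaf_cells.simps(2) order_trans)
qed simp

lemma split_cells_subset: "s \<in> split_cells A T \<Longrightarrow> fst s \<subseteq> A"
proof (induction T arbitrary: A)
  case (Split j z l r)
  from Split.prems consider "s = (A, j, z)"
    | "s \<in> split_cells (left_cell A j z) l" | "s \<in> split_cells (right_cell A j z) r"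
    by auto
  then show ?case
    using Split.IH left_cell_subset[of A j z] right_cell_subset[of A j z]
    by cases (simp, meson order_trans, meson order_trans)
qed simp

lemma finite_split_cells [simp]: "finite (split_cells A T)"
  by (induction T arbitrary: A) auto

text \<open>Rule \<open>split\<close> demands more than \<open>m\<close> observations, hence at
  least one. This later rules out a split cell common to two disjoint subtrees.\<close>

lemma split_cells_num_obs_pos:
  assumes "is_cart_tree m n X Y A T" "s \<in> split_cells A T"
  shows "num_obs n X (fst s) > 0"
  using assms by (induction rule: is_cart_tree.induct) auto

text \<open>Leaves of \<open>r\<close> lie inside the right child, which is disjoint from the left
  one. None of them contains \<open>x\<close>, so they add no index to the set averaged
  over.\<close>

lemma subtree_estimate_left:
  assumes "x \<in> left_cell A j z"
  shows "subtree_estimate n X Y A (Split j z l r) x = subtree_estimate n X Y (left_cell A j z) l x"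
proof -
  have "x \<notin> C" if "C \<in> leaf_cells (right_cell A j z) r" for C
    using leaf_cells_subset[OF that] assms by (auto simp: left_cell_def right_cell_def)
  then have "(\<exists>C\<in>leaf_cells A (Split j z l r). x \<in> C \<and> X i \<in> C) \<longleftrightarrow>
      (\<exists>C\<in>leaf_cells (left_cell A j z) l. x \<in> C \<and> X i \<in> C)" for i
    by auto
  then show ?thesis
    by (simp only: subtree_estimate_def)
qed

lemma subtree_estimate_right:
  assumes "x \<in> right_cell A j z"
  shows "subtree_estimate n X Y A (Split j z l r) x = subtree_estimate n X Y (right_cell A j z) r x"
proof -
  have "x \<notin> C" if "C \<in> leaf_cells (left_cell A j z) l" for C
    using leaf_cells_subset[OF that] assms by (auto simp: left_cell_def right_cell_def)
  then have "(\<exists>C\<in>leaf_cells A (Split j z l r). x \<in> C \<and> X i \<in> C) \<longleftrightarrow>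
      (\<exists>C\<in>leaf_cells (right_cell A j z) r. x \<in> C \<and> X i \<in> C)" for i
    by auto
  then show ?thesis
    by (simp only: subtree_estimate_def)
qed

text \<open>The only leaf is \<open>A\<close> itself, so at a point of \<open>A\<close> the estimate
  averages over exactly \<open>obs n X A\<close>.\<close>

lemma residual_ss_Terminal:
  "residual_ss n X Y A = (\<Sum>i\<in>obs n X A. (Y i - subtree_estimate n X Y A Terminal (X i))\<^sup>2)"
  unfolding residual_ss_def
proof (rule sum.cong)
  fix i assume "i \<in> obs n X A"
  then have "X i \<in> A"
    by (simp add: obs_def)
  then show "(Y i - cell_mean n X Y A)\<^sup>2 = (Y i - subtree_estimate n X Y A Terminal (X i))\<^sup>2"
    by (simp add: cell_mean_def num_obs_def obs_def subtree_estimate_def Let_def)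
qed simp

lemma best_split_left_neq:
  assumes "best_split n X Y A (j, z)"
  shows "left_cell A j z \<noteq> A"
proof -
  obtain i k where "k \<in> obs n X A" "X i $ j < X k $ j" "z = (X i $ j + X k $ j) / 2"
    using assms by (auto simp: best_split_def midpoint_split_def)
  \<comment> \<open>The midpoint \<open>z\<close> lies strictly between the two coordinates, so
    observation \<open>k\<close> falls to the right of the cut.\<close>
  then have "X k \<in> A" "X k \<notin> left_cell A j z"
    by (auto simp: obs_def left_cell_def)
  then show ?thesis
    by blast
qed

lemma best_split_right_neq:
  assumes "best_split n X Y A (j, z)"
  shows "right_cell A j z \<noteq> A"
proof -
  obtain i k where "i \<in> obs n X A" "X i $ j < X k $ j" "z = (X i $ j + X k $ j) / 2"
    using assms by (auto simp: best_split_def midpoint_split_def)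
  then have "X i \<in> A" "X i \<notin> right_cell A j z"
    by (auto simp: obs_def right_cell_def)
  then show ?thesis
    by blast
qed

text \<open>
  Since \<open>split_cells\<close> is a set, no split cell may occur twice in the tree: split cells contain
  observations, and midpoint cuts leave an observation on both sides.
\<close>

lemma sum_split_cells_Split:
  fixes f :: "(real ^ 'd) set \<times> 'd \<times> real \<Rightarrow> real"
  assumes best: "best_split n X Y A (j, z)"
    and l: "is_cart_tree m n X Y (left_cell A j z) l"
    and r: "is_cart_tree m n X Y (right_cell A j z) r"
  shows "sum f (split_cells A (Split j z l r)) =
    f (A, j, z) + sum f (split_cells (left_cell A j z) l) + sum f (split_cells (right_cell A j z) r)"
proof -
  let ?L = "split_cells (left_cell A j z) l" and ?R = "split_cells (right_cell A j z) r"
  \<comment> \<open>Membership would give \<open>A\<close> \<subseteq>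
    \<open>left_cell A j z\<close>, hence equality of the two cells, which a midpoint cut
    excludes.\<close>
  have "(A, j, z) \<notin> ?L"
    using split_cells_subset[of "(A, j, z)" _ l] best_split_left_neq[OF best] left_cell_subset[of A j z] by auto
  moreover have "(A, j, z) \<notin> ?R"
    using split_cells_subset[of "(A, j, z)" _ r] best_split_right_neq[OF best] right_cell_subset[of A j z] by auto
  moreover have "?L \<inter> ?R = {}"
  proof (rule ccontr)
    assume "?L \<inter> ?R \<noteq> {}"
    then obtain s where s: "s \<in> ?L" "s \<in> ?R"
      by blast
    then have "fst s \<subseteq> left_cell A j z \<inter> right_cell A j z"
      using split_cells_subset by blast
    also have "\<dots> = {}"
      by (auto simp: left_cell_def right_cell_def)
    finally show False
      using split_cells_num_obs_pos[OF l s(1)] by (simp add: num_obs_def obs_def)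
  qed
  ultimately show ?thesis
    by (simp add: sum.union_disjoint)
qed

text \<open>This is the telescoping, by induction on the growth of the tree. Both leaf rules give
  \<open>Terminal\<close>, with an empty sum over splits; at a split, the decrease at
  \<open>A\<close> is added to the decompositions of the two children.\<close>

lemma residual_ss_decomposition:
  assumes "is_cart_tree m n X Y A T"
  shows "residual_ss n X Y A =
    (\<Sum>(C, s)\<in>split_cells A T. real (num_obs n X C) * cart_criterion n X Y C s)
    + (\<Sum>i\<in>obs n X A. (Y i - subtree_estimate n X Y A T (X i))\<^sup>2)"
  using assms
proof (induction rule: is_cart_tree.induct)
  case (small A)
  show ?case
    by (simp add: residual_ss_Terminal)
next
  case (tied A)
  show ?case
    by (simp add: residual_ss_Terminal)
next
  case (split A j z l r)
  \<comment> \<open>The induction hypotheses speak of the estimates of \<open>l\<close> and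
    \<open>r\<close>; on the observations of each child these agree with the estimate of the whole
    tree.\<close>
  have L: "(\<Sum>i\<in>obs n X (left_cell A j z). (Y i - subtree_estimate n X Y A (Split j z l r) (X i))\<^sup>2) =
      (\<Sum>i\<in>obs n X (left_cell A j z). (Y i - subtree_estimate n X Y (left_cell A j z) l (X i))\<^sup>2)"
    by (rule sum.cong) (auto simp: obs_def subtree_estimate_left)
  have R: "(\<Sum>i\<in>obs n X (right_cell A j z). (Y i - subtree_estimate n X Y A (Split j z l r) (X i))\<^sup>2) =
      (\<Sum>i\<in>obs n X (right_cell A j z). (Y i - subtree_estimate n X Y (right_cell A j z) r (X i))\<^sup>2)"
    by (rule sum.cong) (auto simp: obs_def subtree_estimate_right)
  have "num_obs n X A > 0"
    using split.hyps(1) by simp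
  from num_obs_times_cart_criterion[OF this, of Y j z] show ?case
    using split.IH sum_obs_children[of "\<lambda>i. (Y i - subtree_estimate n X Y A (Split j z l r) (X i))\<^sup>2" n X A j z]
    by (simp only: sum_split_cells_Split[OF split.hyps(2-4)] L R prod.case)
qed

text \<open>Each split has exactly one direction, so the index sets of the \<open>emp_MDI\<close>
  sums partition the finite set \<open>split_cells root_cell T\<close>.\<close>

lemma sum_emp_MDI:
  fixes T :: "'d::finite split_tree"
  shows "(\<Sum>j\<in>UNIV. emp_MDI n X Y T j) =
    (\<Sum>(C, s)\<in>split_cells root_cell T. real (num_obs n X C) * cart_criterion n X Y C s) / real n"
proof -
  let ?g = "\<lambda>(C, s). real (num_obs n X C) / real n * cart_criterion n X Y C s"
  have "emp_MDI n X Y T j = sum ?g {s \<in> split_cells root_cell T. fst (snd s) = j}" for j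
    unfolding emp_MDI_def by (rule sum.cong) auto
  then have "(\<Sum>j\<in>UNIV. emp_MDI n X Y T j) = sum ?g (split_cells root_cell T)"
    by (simp add: sum.group)
  then show ?thesis
    by (simp add: sum_divide_distrib case_prod_unfold)
qed

theorem proposition2:
  fixes M :: "'w measure"
    and X :: "'w \<Rightarrow> real ^ 'd" and Y :: "'w \<Rightarrow> real"
    and Xs :: "nat \<Rightarrow> 'w \<Rightarrow> real ^ 'd" and Ys :: "nat \<Rightarrow> 'w \<Rightarrow> real"
    and n nodesize :: nat and \<omega> :: 'w and T :: "'d split_tree"
  assumes "prob_space M"
    and "X \<in> borel_measurable M" and "Y \<in> borel_measurable M"
    and "\<And>w. w \<in> space M \<Longrightarrow> X w \<in> root_cell"
    and "integrable M (\<lambda>w. (Y w)\<^sup>2)"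
    and "n \<ge> 1"
    and "\<And>i w. i \<in> {1..n} \<Longrightarrow> w \<in> space M \<Longrightarrow> Xs i w \<in> root_cell"
    and "prob_space.indep_vars M (\<lambda>_. borel) (\<lambda>i w. (Xs i w, Ys i w)) {1..n}"
    and "\<And>i. i \<in> {1..n} \<Longrightarrow>
      distr M borel (\<lambda>w. (Xs i w, Ys i w)) = distr M borel (\<lambda>w. (X w, Y w))"
    and "nodesize \<ge> 1"
    and "\<omega> \<in> space M"
    and "is_cart_tree nodesize n (\<lambda>i. Xs i \<omega>) (\<lambda>i. Ys i \<omega>) root_cell T"
  shows "emp_variance n (\<lambda>i. Ys i \<omega>) =
      (\<Sum>j\<in>UNIV. emp_MDI n (\<lambda>i. Xs i \<omega>) (\<lambda>i. Ys i \<omega>) T j)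
      + emp_risk n (\<lambda>i. Xs i \<omega>) (\<lambda>i. Ys i \<omega>)
          (tree_estimate n (\<lambda>i. Xs i \<omega>) (\<lambda>i. Ys i \<omega>) T)"
proof -
  let ?X = "\<lambda>i. Xs i \<omega>" and ?Y = "\<lambda>i. Ys i \<omega>"
  \<comment> \<open>At the outcome \<omega> all sample points lie in \<open>root_cell\<close>, so
    the mean and the residual sum of squares of the root cell are taken over the whole
    sample.\<close>
  have obs_root: "obs n ?X root_cell = {1..n}"
    using assms(7)[OF _ assms(11)] by (auto simp: obs_def)
  have "emp_variance n ?Y = residual_ss n ?X ?Y root_cell / real n"
    by (simp add: emp_variance_def residual_ss_def emp_mean_def cell_mean_def num_obs_def obs_root)
  moreover have "tree_estimate n ?X ?Y T = subtree_estimate n ?X ?Y root_cell T"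
    by (simp add: fun_eq_iff tree_estimate_def subtree_estimate_def)
  ultimately show ?thesis
    using residual_ss_decomposition[OF assms(12)]
    by (simp add: emp_risk_def sum_emp_MDI obs_root add_divide_distrib)
qed

end
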